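(* Let $d$ be even and let $(Y,Z)$ be a cross-intersecting EKR set of generators of $Q^+(2d-1,q)$ of maximum size. Then $Y=X_i$ and $Z=X_j$ with $\{i,j\}=\{1,2\}$, where $X_1,X_2$ are the two classes (latins and greeks) of generators of $Q^+(2d-1,q)$.
   Context: All dimensions are vector space dimensions. $Q^+(2d-1,q)$ is the hyperbolic quadric of rank $d$ in $\mathrm{PG}(2d-1,q)$; generators are its totally singular subspaces of the maximal dimension $d$. A cross-intersecting EKR set of generators is a pair $(Y,Z)$ of sets of generators such that every $y\in Y$ and $z\in Z$ satisfy $\dim(y\cap z)\ge1$; it is of maximum size if $|Y|\cdot|Z|$ is maximum among all cross-intersecting EKR sets of the polar space. The set of all generators of $Q^+(2d-1,q)$ is partitioned into two classes $X_1,X_2$ of equal size (latins and greeks) such that $d-\dim(x\cap y)$ is even if $x,y$ are in the same class and odd if they are in different classes. *)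

theory Defs
  imports "HOL-Analysis.Cartesian_Space"
begin

text \<open>
  The projective space \<open>PG(2d-1,q)\<close> is the lattice of subspaces of \<open>'a^'n\<close>, where \<open>'a\<close> is a finite
  field with \<open>q\<close> elements and \<open>CARD('n) = 2 * d\<close>. All dimensions are vector space dimensions.
\<close>

definition polar_form :: "('a::field^'n \<Rightarrow> 'a) \<Rightarrow> 'a^'n \<Rightarrow> 'a^'n \<Rightarrow> 'a" where
  "polar_form Q x y = Q (x + y) - Q x - Q y"

text \<open>The polar form is symmetric, so linearity in the first argument gives bilinearity. The
  definition is valid in every characteristic, including 2.\<close>

definition quadratic_form :: "('a::field^'n \<Rightarrow> 'a) \<Rightarrow> bool" where
  "quadratic_form Q \<longleftrightarrow>
     (\<forall>c x. Q (c *s x) = c ^ 2 * Q x) \<and>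
     (\<forall>x y z. polar_form Q (x + y) z = polar_form Q x z + polar_form Q y z) \<and>
     (\<forall>c x y. polar_form Q (c *s x) y = c * polar_form Q x y)"

text \<open>No nonzero singular vector lies in the radical of the polar form.\<close>

definition nondegenerate_form :: "('a::field^'n \<Rightarrow> 'a) \<Rightarrow> bool" where
  "nondegenerate_form Q \<longleftrightarrow> (\<forall>x. Q x = 0 \<and> (\<forall>y. polar_form Q x y = 0) \<longrightarrow> x = 0)"

definition totally_singular :: "('a::field^'n \<Rightarrow> 'a) \<Rightarrow> ('a^'n) set \<Rightarrow> bool" where
  "totally_singular Q U \<longleftrightarrow> vec.subspace U \<and> (\<forall>u\<in>U. Q u = 0)"

text \<open>\<open>Q\<close> defines a hyperbolic quadric \<open>Q\<^sup>+(2d-1,q)\<close>: a nondegenerate quadric in \<open>PG(2d-1,q)\<close> whose rank,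
  the largest dimension of a totally singular subspace, is \<open>d\<close>.\<close>

definition hyperbolic_quadric :: "nat \<Rightarrow> ('a::{field,finite}^'n \<Rightarrow> 'a) \<Rightarrow> bool" where
  "hyperbolic_quadric d Q \<longleftrightarrow>
     CARD('n) = 2 * d \<and> quadratic_form Q \<and> nondegenerate_form Q \<and>
     (\<exists>U. totally_singular Q U \<and> vec.dim U = d) \<and>
     (\<forall>U. totally_singular Q U \<longrightarrow> vec.dim U \<le> d)"

definition generators :: "nat \<Rightarrow> ('a::field^'n \<Rightarrow> 'a) \<Rightarrow> ('a^'n) set set" where
  "generators d Q = {U. totally_singular Q U \<and> vec.dim U = d}"

definition cross_intersecting_EKR ::
  "nat \<Rightarrow> ('a::field^'n \<Rightarrow> 'a) \<Rightarrow> ('a^'n) set set \<Rightarrow> ('a^'n) set set \<Rightarrow> bool" where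
  "cross_intersecting_EKR d Q Y Z \<longleftrightarrow>
     Y \<subseteq> generators d Q \<and> Z \<subseteq> generators d Q \<and> (\<forall>y\<in>Y. \<forall>z\<in>Z. vec.dim (y \<inter> z) \<ge> 1)"

definition maximum_cross_intersecting_EKR ::
  "nat \<Rightarrow> ('a::field^'n \<Rightarrow> 'a) \<Rightarrow> ('a^'n) set set \<Rightarrow> ('a^'n) set set \<Rightarrow> bool" where
  "maximum_cross_intersecting_EKR d Q Y Z \<longleftrightarrow>
     cross_intersecting_EKR d Q Y Z \<and>
     (\<forall>Y' Z'. cross_intersecting_EKR d Q Y' Z' \<longrightarrow> card Y' * card Z' \<le> card Y * card Z)"

text \<open>\<open>X1\<close> and \<open>X2\<close> are the two classes of generators (latins and greeks, in either order). The
  subtraction on \<open>nat\<close> does not truncate, as \<open>x \<inter> y\<close> is contained in \<open>x\<close>, which has dimension \<open>d\<close>.\<close>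

definition latins_and_greeks ::
  "nat \<Rightarrow> ('a::field^'n \<Rightarrow> 'a) \<Rightarrow> ('a^'n) set set \<Rightarrow> ('a^'n) set set \<Rightarrow> bool" where
  "latins_and_greeks d Q X1 X2 \<longleftrightarrow>
     X1 \<union> X2 = generators d Q \<and> X1 \<inter> X2 = {} \<and> card X1 = card X2 \<and>
     (\<forall>x\<in>X1. \<forall>y\<in>X1. even (d - vec.dim (x \<inter> y))) \<and>
     (\<forall>x\<in>X2. \<forall>y\<in>X2. even (d - vec.dim (x \<inter> y))) \<and>
     (\<forall>x\<in>X1. \<forall>y\<in>X2. odd (d - vec.dim (x \<inter> y)))"

end

theory Submission
  imports Defs
begin

text \<open>
  Call two generators opposite if they meet trivially. A cross-intersecting pair \<open>(Y, Z)\<close> is a pair of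
  sets of vertices with no edge between them in the graph of opposition. Three properties of this graph
  give the theorem.

  \<^item> It is regular of positive degree (\<open>card_opposites\<close>, \<open>card_opposites_pos\<close>). Two generators that
    share a hyperplane are exchanged by a reflection (\<open>adjacent_reflect\<close>), and any two generators are
    joined by a chain of such steps (\<open>generator_adjacent_induct\<close>), so all generators look alike.
  \<^item> For even \<open>d\<close> an edge joins generators of the same class, since \<open>d - 0\<close> is even. Hence
    the pair formed by the two classes is cross-intersecting.
  \<^item> Any two generators of the same class have a common neighbour (\<open>common_opposite\<close>).

  Let \<open>n\<close> be the number of generators. All edges at \<open>Z\<close> end in the complement \<open>C\<close> of \<open>Y\<close>, and
  regularity turns this into \<open>|Z| \<le> |C| = n - |Y|\<close>. The two classes have size \<open>n/2\<close> each, so a pair of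
  maximum size has \<open>|Y| |Z| \<ge> (n/2)^2\<close>, while \<open>|Y| + |Z| \<le> n\<close>. Both can hold only if
  \<open>|Y| = |Z| = n/2\<close>, and then the count of edges is tight: every edge at \<open>C\<close> ends in \<open>Z\<close>
  (\<open>regular_graph_independent_pair\<close>). If \<open>z \<in> Z\<close> and \<open>x\<close> is in the class of \<open>z\<close>, their common
  neighbour is in \<open>C\<close>, so \<open>x \<in> Z\<close>. Thus \<open>Z\<close> contains a whole class, and equals it because the
  sizes agree. A generator of the other class outside \<open>Y\<close> would have all its neighbours in \<open>Z\<close>, but they
  lie in its own class; so \<open>Y\<close> is the other class.

  The geometry behind the three properties is the behaviour of a generator \<open>U\<close> with respect to two
  generators \<open>W\<close>, \<open>W'\<close> that share a hyperplane: the dimensions of \<open>W \<inter> U\<close> and \<open>W' \<inter> U\<close> always differ by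
  exactly one (\<open>adjacent_dim_meet\<close>). So each step along a chain changes the parity of the codimension of
  the intersection with \<open>U\<close>, which yields the two classes (\<open>same_class_trans\<close>,
  \<open>latins_and_greeks_classes\<close>). All arguments hold in every characteristic.
\<close>

section \<open>Linear algebra of the polar form\<close>

lemma exists_complement_spanning_set:
  fixes A C :: "('a::field^'n) set"
  assumes A: "vec.subspace A" and AC: "A \<subseteq> C"
  obtains T where "finite T" "T \<subseteq> C" "card T + vec.dim A = vec.dim C" "C \<subseteq> vec.span (A \<union> T)"
proof -
  obtain S where S: "S \<subseteq> A" "vec.independent S" "A \<subseteq> vec.span S" "card S = vec.dim A"
    by (rule vec.basis_exists)
  obtain D where D: "S \<subseteq> D" "D \<subseteq> C" "vec.independent D" "C \<subseteq> vec.span D"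
    using vec.maximal_independent_subset_extend[of S C] S AC by blast
  have fin: "finite D" using D(3) by (rule vec.finiteI_independent)
  have cD: "card D = vec.dim C" using D vec.basis_card_eq_dim by blast
  show thesis
  proof (rule that)
    show "finite (D - S)" using fin by simp
    show "D - S \<subseteq> C" using D by blast
    show "card (D - S) + vec.dim A = vec.dim C"
      using S(4) cD card_mono[OF fin D(1)] card_Diff_subset[OF finite_subset[OF D(1) fin] D(1)] by simp
    have "D \<subseteq> A \<union> (D - S)" using S by blast
    then show "C \<subseteq> vec.span (A \<union> (D - S))" using D(4) vec.span_mono by blast
  qed
qed

lemma dim_Suc_if_hyperplane:
  fixes S H :: "('a::field^'n) set"
  assumes "vec.subspace H" "H \<subseteq> S" "x \<in> S" "x \<notin> H" "\<And>y. y \<in> S \<Longrightarrow> \<exists>c. y - c *s x \<in> H"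
  shows "vec.dim S = vec.dim H + 1"
proof -
  have sp: "vec.span H = H" using assms(1) by (simp add: vec.span_eq_iff)
  have "S \<subseteq> vec.span (insert x H)"
  proof
    show "y \<in> vec.span (insert x H)" if "y \<in> S" for y
      unfolding vec.span_breakdown_eq sp by (rule assms(5)[OF that])
  qed
  then have "vec.dim S \<le> vec.dim (insert x H)" using vec.dim_subset[of S "vec.span (insert x H)"] by simp
  moreover have "vec.dim (insert x H) \<le> vec.dim S" using assms by (intro vec.dim_subset) auto
  ultimately show ?thesis using vec.dim_insert[of x H] assms(4) unfolding sp by simp
qed

lemma hyperplane_decompose:
  fixes S H :: "('a::field^'n) set"
  assumes "vec.subspace H" "vec.subspace S" "H \<subseteq> S" "vec.dim S \<le> vec.dim H + 1" "x \<in> S" "x \<notin> H" "y \<in> S"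
  obtains c where "y - c *s x \<in> H"
proof -
  have sp: "vec.span H = H" using assms(1) by (simp add: vec.span_eq_iff)
  have "vec.span (insert x H) \<subseteq> S" using assms by (intro vec.span_minimal) auto
  moreover have "vec.dim (vec.span (insert x H)) \<ge> vec.dim S"
    using assms(4,6) vec.dim_insert[of x H] unfolding vec.dim_span sp by simp
  ultimately have "vec.span (insert x H) = S"
    using assms(2) vec.subspace_dim_equal[of "vec.span (insert x H)" S] by simp
  then have "y \<in> vec.span (insert x H)" using assms(7) by simp
  then obtain c where "y - c *s x \<in> H" unfolding vec.span_breakdown_eq sp by (rule exE)
  then show thesis by (rule that)
qed

text \<open>
  Trivial intersection is expressed below by the equation \<open>vec.dim (U \<inter> W) = 0\<close>; rewriting it into an
  inclusion would hide it from arithmetic.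
\<close>

declare vec.dim_eq_0 [simp del]

locale hyperbolic_space =
  fixes d :: nat and Q :: "'a::{field,finite}^'n \<Rightarrow> 'a"
  assumes hyp: "hyperbolic_quadric d Q"
begin

abbreviation B where "B \<equiv> polar_form Q"
abbreviation G where "G \<equiv> generators d Q"

lemma Q_scale: "Q (c *s x) = c ^ 2 * Q x"
  using hyp by (simp add: hyperbolic_quadric_def quadratic_form_def)

lemma B_sym: "B x y = B y x" by (simp add: polar_form_def add.commute)

lemma B_add: "B (x + y) z = B x z + B y z" "B z (x + y) = B z x + B z y"
  using hyp B_sym by (auto simp: hyperbolic_quadric_def quadratic_form_def)

lemma B_scale: "B (c *s x) y = c * B x y" "B y (c *s x) = c * B y x"
  using hyp B_sym by (auto simp: hyperbolic_quadric_def quadratic_form_def)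

lemma B_zero: "B 0 y = 0" "B y 0 = 0"
  using B_scale(1)[of 0 0 y] B_scale(2)[of y 0 0] by simp_all

lemma B_diff: "B (x - y) z = B x z - B y z" "B z (x - y) = B z x - B z y"
proof -
  show "B (x - y) z = B x z - B y z" for x y z
    using B_add(1)[of "x - y" y z] by simp
  then show "B z (x - y) = B z x - B z y" by (metis B_sym)
qed

lemma Q_zero: "Q 0 = 0" using Q_scale[of 0 0] by simp

lemma Q_add: "Q (x + y) = Q x + Q y + B x y" by (simp add: polar_form_def)

lemma Q_diff: "Q (x - y) = Q x + Q y - B x y"
proof -
  have "Q (x - y) = Q (x + (-1) *s y)" by simp
  also have "\<dots> = Q x + Q y - B x y" by (simp only: Q_add Q_scale B_scale) simp
  finally show ?thesis .
qed

lemma B_self: "B x x = 2 * Q x"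
  using Q_diff[of x x] by (simp add: Q_zero)

lemma nondegenerate: "Q x = 0 \<Longrightarrow> (\<And>y. B x y = 0) \<Longrightarrow> x = 0"
  using hyp by (auto simp: hyperbolic_quadric_def nondegenerate_form_def)

lemma CARD: "CARD('n) = 2 * d" and d_pos: "0 < d"
proof -
  show c: "CARD('n) = 2 * d" using hyp by (simp add: hyperbolic_quadric_def)
  then show "0 < d" using zero_less_card_finite[where 'a='n] by linarith
qed

lemma generators_nonempty: "G \<noteq> {}"
  using hyp by (auto simp: hyperbolic_quadric_def generators_def)

lemma generatorD:
  assumes "U \<in> G"
  shows "vec.subspace U" "\<And>u. u \<in> U \<Longrightarrow> Q u = 0" "vec.dim U = d"
  using assms by (auto simp: generators_def totally_singular_def)

lemma generator_orth: "U \<in> G \<Longrightarrow> u \<in> U \<Longrightarrow> v \<in> U \<Longrightarrow> B u v = 0"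
  by (simp add: generatorD(2) polar_form_def vec.subspace_add[OF generatorD(1)])

lemma subspace_perp: "vec.subspace {x. \<forall>t\<in>T. B t x = 0}"
  by (rule vec.subspaceI) (auto simp: B_add B_scale B_zero)

lemma subspace_inter_perp: "vec.subspace S \<Longrightarrow> vec.subspace {x\<in>S. \<forall>t\<in>T. B t x = 0}"
  unfolding Collect_conj_eq Collect_mem_eq by (intro vec.subspace_inter subspace_perp)

text \<open>
  Each vector of \<open>T\<close> imposes one linear condition, and the conditions may be dependent.
\<close>

lemma dim_inter_perp:
  assumes "finite T" "vec.subspace S"
  shows "vec.dim S \<le> vec.dim {x\<in>S. \<forall>t\<in>T. B t x = 0} + card T"
  using assms(1)
proof induction
  case empty
  then show ?case by simp
next
  case (insert e T)
  let ?A = "{x\<in>S. \<forall>t\<in>T. B t x = 0}" and ?A' = "{x\<in>S. \<forall>t\<in>insert e T. B t x = 0}"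
  have "vec.dim ?A \<le> vec.dim ?A' + 1"
  proof (cases "?A = ?A'")
    case False
    then obtain s where s: "s \<in> ?A" "B e s \<noteq> 0" by auto
    have sub: "vec.subspace ?A'" "vec.subspace ?A" using subspace_inter_perp assms(2) by blast+
    have "\<exists>c. y - c *s s \<in> ?A'" if y: "y \<in> ?A" for y
    proof
      have "y - (B e y / B e s) *s s \<in> ?A"
        using y s(1) sub by (simp only: vec.subspace_diff vec.subspace_scale)
      moreover have "B e (y - (B e y / B e s) *s s) = 0" using s by (simp add: B_diff B_scale)
      ultimately show "y - (B e y / B e s) *s s \<in> ?A'" by simp
    qed
    note decompose = this
    have "?A' \<subseteq> ?A" "s \<notin> ?A'" using s(2) by blast+
    then have "vec.dim ?A = vec.dim ?A' + 1"
      by (rule dim_Suc_if_hyperplane[OF sub(1) _ s(1) _ decompose])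
    then show ?thesis by (rule eq_imp_le)
  qed simp
  then show ?case using insert by simp
qed

text \<open>
  A vector \<open>u \<in> U\<close> that is also orthogonal to a complement of \<open>U^\<bottom>\<close> lies in the radical of the polar
  form and is singular, hence zero. So the vectors of a complement impose at least \<open>d\<close> conditions
  on \<open>U\<close>, which bounds the dimension of \<open>U^\<bottom>\<close> by \<open>2 * d - d\<close>.
\<close>

lemma generator_perp_self:
  assumes U: "U \<in> G" and x: "\<And>u. u \<in> U \<Longrightarrow> B u x = 0"
  shows "x \<in> U"
proof -
  let ?P = "{x. \<forall>u\<in>U. B u x = 0}"
  have UP: "U \<subseteq> ?P" using generator_orth[OF U] by blast
  obtain T where T: "finite T" "card T + vec.dim ?P = vec.dim (UNIV :: ('a^'n) set)"
    "UNIV \<subseteq> vec.span (?P \<union> T)"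
    by (rule exists_complement_spanning_set[OF subspace_perp subset_UNIV])
  let ?S = "{u\<in>U. \<forall>t\<in>T. B t u = 0}"
  have "?S \<subseteq> {0}"
  proof
    fix u assume u: "u \<in> ?S"
    have "?P \<union> T \<subseteq> {x. \<forall>t\<in>{u}. B t x = 0}" using u by (auto simp: B_sym[of u])
    then have "vec.span (?P \<union> T) \<subseteq> {x. \<forall>t\<in>{u}. B t x = 0}"
      by (rule vec.span_minimal[OF _ subspace_perp])
    then have "B u y = 0" for y using T(3) by auto
    moreover have "Q u = 0" using generatorD(2)[OF U] u by simp
    ultimately have "u = 0" by (intro nondegenerate)
    then show "u \<in> {0}" by simp
  qed
  then have "vec.dim ?S = 0" by (simp add: vec.dim_eq_0)
  then have "d \<le> card T" using dim_inter_perp[OF T(1) generatorD(1)[OF U]] generatorD(3)[OF U] by linarith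
  moreover have "vec.dim (UNIV :: ('a^'n) set) = 2 * d" unfolding vec_dim_card by (rule CARD)
  ultimately have "vec.dim ?P \<le> vec.dim U" using T(2) generatorD(3)[OF U] by linarith
  then have "U = ?P" by (intro vec.subspace_dim_equal generatorD(1)[OF U] subspace_perp UP)
  then show ?thesis using x by blast
qed

section \<open>Adjacent generators\<close>

definition adjacent :: "('a^'n) set \<Rightarrow> ('a^'n) set \<Rightarrow> bool" where
  "adjacent U W \<longleftrightarrow> U \<in> G \<and> W \<in> G \<and> vec.dim (U \<inter> W) + 1 = d"

lemma adjacent_sym: "adjacent U W \<Longrightarrow> adjacent W U"
  by (simp add: adjacent_def Int_commute)

lemma adjacentD: "adjacent U W \<Longrightarrow> U \<in> G" "adjacent U W \<Longrightarrow> W \<in> G"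
  by (simp_all add: adjacent_def)

lemma subspace_meet: "U \<in> G \<Longrightarrow> W \<in> G \<Longrightarrow> vec.subspace (U \<inter> W)"
  by (intro vec.subspace_inter generatorD(1))

lemma generator_not_subset:
  assumes "U \<in> G" "W \<in> G" "U \<noteq> W"
  obtains w where "w \<in> W" "w \<notin> U"
proof -
  have "\<not> W \<subseteq> U"
    using assms vec.subspace_dim_equal[of W U] generatorD(1,3)[of U] generatorD(1,3)[of W] by auto
  then show thesis using that by blast
qed

lemma adjacent_neq: "adjacent U W \<Longrightarrow> U \<noteq> W"
  using generatorD(3)[of U] by (auto simp: adjacent_def)

lemma adjacent_decompose:
  assumes adj: "adjacent W W'" and x: "x \<in> W" "x \<notin> W'" and y: "y \<in> W"
  obtains c where "y - c *s x \<in> W \<inter> W'"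
proof -
  note W = adjacentD[OF adj]
  have "vec.dim W \<le> vec.dim (W \<inter> W') + 1" using adj generatorD(3)[OF W(1)] by (simp add: adjacent_def)
  then show thesis
    using hyperplane_decompose[OF subspace_meet[OF W] generatorD(1)[OF W(1)] Int_lower1 _ x(1) _ y] x that
    by blast
qed

lemma adjacent_perp:
  assumes adj: "adjacent W W'" and x: "x \<in> W" "x \<notin> W'"
    and z: "\<And>h. h \<in> W \<inter> W' \<Longrightarrow> B h z = 0" "B x z = 0"
  shows "z \<in> W"
proof (rule generator_perp_self[OF adjacentD(1)[OF adj]])
  fix y assume "y \<in> W"
  then obtain c where "y - c *s x \<in> W \<inter> W'" using adjacent_decompose[OF adj x] by blast
  then show "B y z = 0" using z(1)[of "y - c *s x"] z(2) by (simp add: B_diff B_scale)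
qed

lemma adjacent_nonorthogonal:
  assumes adj: "adjacent W W'" and "x \<in> W" "x \<notin> W'" "x' \<in> W'" "x' \<notin> W"
  shows "B x x' \<noteq> 0"
  using adjacent_perp[OF adj assms(2,3), of x'] assms generator_orth[OF adjacentD(2)[OF adj]] by blast

text \<open>
  A vector of \<open>W' \<inter> U\<close> outside \<open>W\<close> would be orthogonal to \<open>x\<close>, as both lie in \<open>U\<close>, and this contradicts
  \<open>adjacent_nonorthogonal\<close>. So \<open>W' \<inter> U\<close> lies in \<open>W \<inter> U\<close>, and it is a hyperplane there because
  \<open>W \<inter> W'\<close> is one in \<open>W\<close>.
\<close>

lemma dim_meet_drop:
  assumes adj: "adjacent W W'" and U: "U \<in> G" and x: "x \<in> U" "x \<in> W" "x \<notin> W'"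
  shows "vec.dim (W \<inter> U) = vec.dim (W' \<inter> U) + 1"
proof -
  note W = adjacentD[OF adj]
  have sub: "W' \<inter> U \<subseteq> W"
    using adjacent_nonorthogonal[OF adj x(2,3)] generator_orth[OF U x(1)] by blast
  show ?thesis
  proof (rule dim_Suc_if_hyperplane[OF subspace_meet[OF W(2) U]])
    show "W' \<inter> U \<subseteq> W \<inter> U" "x \<in> W \<inter> U" "x \<notin> W' \<inter> U" using sub x by auto
    fix y assume y: "y \<in> W \<inter> U"
    then obtain c where c: "y - c *s x \<in> W \<inter> W'" using adjacent_decompose[OF adj x(2,3)] by blast
    have "y - c *s x \<in> U" using y x generatorD(1)[OF U] by (blast intro: vec.subspace_diff vec.subspace_scale)
    then show "\<exists>c. y - c *s x \<in> W' \<inter> U" using c by blast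
  qed
qed

text \<open>
  This is where the quadric being hyperbolic enters: the hyperplane \<open>H = W \<inter> W'\<close> lies in no
  generators besides \<open>W\<close> and \<open>W'\<close>. Counting conditions gives a vector \<open>w \<in> U\<close> that is orthogonal to \<open>H\<close>
  but not in it. It lies in \<open>H^\<bottom> = W + W'\<close>, and modulo \<open>H\<close> the form \<open>Q\<close> is that of a hyperbolic line
  spanned by \<open>u \<in> W\<close> and \<open>u' \<in> W'\<close>, so the singular vector \<open>w\<close> is in \<open>W\<close> or in \<open>W'\<close>. That the
  two alternatives exclude each other follows from \<open>dim_meet_drop\<close>.
\<close>

lemma generator_meets_one_side:
  assumes adj: "adjacent W W'" and U: "U \<in> G"
  obtains x where "x \<in> U" "x \<in> W" "x \<notin> W'" | x where "x \<in> U" "x \<in> W'" "x \<notin> W"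
proof -
  note W = adjacentD[OF adj]
  let ?H = "W \<inter> W'"
  obtain T where T: "finite T" "T \<subseteq> ?H" "card T + vec.dim (?H \<inter> U) = vec.dim ?H"
    "?H \<subseteq> vec.span ((?H \<inter> U) \<union> T)"
    by (rule exists_complement_spanning_set[of "?H \<inter> U" ?H])
      (auto intro: vec.subspace_inter subspace_meet[OF W] generatorD(1)[OF U])
  let ?S = "{x\<in>U. \<forall>t\<in>T. B t x = 0}"
  have "vec.dim (?H \<inter> U) < vec.dim ?S"
    using dim_inter_perp[OF T(1) generatorD(1)[OF U]] T(3) adj generatorD(3)[OF U]
    unfolding adjacent_def by linarith
  then have "\<not> ?S \<subseteq> ?H \<inter> U" using vec.dim_subset[of ?S "?H \<inter> U"] by linarith
  then obtain w where w: "w \<in> U" "\<And>t. t \<in> T \<Longrightarrow> B t w = 0" "w \<notin> ?H" by blast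
  have "(?H \<inter> U) \<union> T \<subseteq> {x. \<forall>t\<in>{w}. B t x = 0}"
    using w(2) generator_orth[OF U w(1)] by (auto simp: B_sym[of w])
  then have "vec.span ((?H \<inter> U) \<union> T) \<subseteq> {x. \<forall>t\<in>{w}. B t x = 0}"
    by (rule vec.span_minimal[OF _ subspace_perp])
  then have wH: "B h w = 0" if "h \<in> ?H" for h using T(4) that by (auto simp: B_sym[of h])
  obtain u where u: "u \<in> W" "u \<notin> W'" using generator_not_subset[OF W(2,1)] adjacent_neq[OF adj] by metis
  obtain u' where u': "u' \<in> W'" "u' \<notin> W" using generator_not_subset[OF W] adjacent_neq[OF adj] by metis
  \<comment> \<open>Subtract from \<open>w\<close> its components along \<open>u\<close> and \<open>u'\<close>; the rest \<open>h\<close> is orthogonal to \<open>W\<close> and \<open>W'\<close>,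
    and therefore belongs to both.\<close>
  define b where "b = B u u'"
  have b: "b \<noteq> 0" unfolding b_def by (rule adjacent_nonorthogonal[OF adj u u'])
  define \<alpha> \<beta> where "\<alpha> = B w u' / b" and "\<beta> = B w u / b"
  define h where "h = w - \<alpha> *s u - \<beta> *s u'"
  have uu: "B u u = 0" "B u' u' = 0" "B u' u = b"
    using generator_orth[OF W(1) u(1) u(1)] generator_orth[OF W(2) u'(1) u'(1)] B_sym[of u u']
    by (auto simp: b_def)
  have hu: "B u h = 0" "B u' h = 0"
    using b uu by (simp_all add: h_def B_diff B_scale \<alpha>_def \<beta>_def b_def[symmetric] B_sym[of _ w])
  have hH: "B g h = 0" if "g \<in> ?H" for g
    using wH[OF that] generator_orth[OF W(1), of g u] generator_orth[OF W(2), of g u'] that u u'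
    by (simp add: h_def B_diff B_scale)
  have hW: "h \<in> W" by (rule adjacent_perp[OF adj u hH hu(1)])
  have hW': "h \<in> W'" by (rule adjacent_perp[OF adjacent_sym[OF adj] u' _ hu(2)]) (use hH in blast)
  have w_eq: "w = h + (\<alpha> *s u + \<beta> *s u')" by (simp add: h_def)
  have "Q w = \<alpha> * (\<beta> * b)"
    unfolding w_eq Q_add Q_scale B_add B_scale
    using generatorD(2)[OF W(1) hW] generatorD(2)[OF W(1) u(1)] generatorD(2)[OF W(2) u'(1)] hu
    by (simp add: B_sym[of h] b_def)
  then have "\<alpha> = 0 \<or> \<beta> = 0" using generatorD(2)[OF U w(1)] b by simp
  then show thesis
  proof
    assume "\<alpha> = 0"
    then have "w \<in> W'" using w_eq hW' u' generatorD(1)[OF W(2)]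
      by (simp add: vec.subspace_add vec.subspace_scale)
    then show thesis using that(2) w by blast
  next
    assume "\<beta> = 0"
    then have "w \<in> W" using w_eq hW u generatorD(1)[OF W(1)]
      by (simp add: vec.subspace_add vec.subspace_scale)
    then show thesis using that(1) w by blast
  qed
qed

lemma adjacent_dim_meet:
  assumes "adjacent W W'" "U \<in> G"
  shows "vec.dim (W \<inter> U) = vec.dim (W' \<inter> U) + 1 \<or> vec.dim (W' \<inter> U) = vec.dim (W \<inter> U) + 1"
  using generator_meets_one_side[OF assms] dim_meet_drop[OF assms]
    dim_meet_drop[OF adjacent_sym[OF assms(1)] assms(2)] by metis

text \<open>
  For a singular vector \<open>w\<close> outside the generator \<open>W\<close>, this is the unique generator through \<open>w\<close> that shares
  a hyperplane with \<open>W\<close>.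
\<close>

definition pivot :: "('a^'n) set \<Rightarrow> 'a^'n \<Rightarrow> ('a^'n) set" where
  "pivot W w = vec.span (insert w {x\<in>W. B w x = 0})"

lemma pivot_generator:
  assumes W: "W \<in> G" and w: "Q w = 0" "w \<notin> W"
  shows "adjacent W (pivot W w)" "w \<in> pivot W w" "W \<inter> pivot W w = {x\<in>W. B w x = 0}"
proof -
  let ?H = "{x\<in>W. B w x = 0}"
  note sW = generatorD(1)[OF W]
  have sH: "vec.subspace ?H" using subspace_inter_perp[OF sW, of "{w}"] by simp
  have spH: "vec.span ?H = ?H" using sH by (simp only: vec.span_eq_iff)
  have mem: "y \<in> pivot W w \<longleftrightarrow> (\<exists>c. y - c *s w \<in> ?H)" for y
    by (simp only: pivot_def vec.span_breakdown_eq spH)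
  have "\<not> W \<subseteq> ?H" using generator_perp_self[OF W, of w] w(2) B_sym by fastforce
  then have "?H \<subset> W" by blast
  then have "vec.span ?H \<subset> vec.span W" using sW spH by (simp only: vec.span_eq_iff[THEN iffD2])
  then have "vec.dim ?H < d" using vec.dim_psubset generatorD(3)[OF W] by metis
  moreover have "d \<le> vec.dim ?H + 1"
    using dim_inter_perp[of "{w}" W] sW generatorD(3)[OF W] by simp
  ultimately have dH: "vec.dim ?H + 1 = d" by linarith
  show meet: "W \<inter> pivot W w = ?H"
  proof
    show "?H \<subseteq> W \<inter> pivot W w" by (auto simp: pivot_def intro: vec.span_base)
    show "W \<inter> pivot W w \<subseteq> ?H"
    proof
      fix y assume y: "y \<in> W \<inter> pivot W w"
      then obtain c where c: "y - c *s w \<in> ?H" using mem by blast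
      then have "y - (y - c *s w) \<in> W" using y sW by (blast intro: vec.subspace_diff)
      then have "c *s w \<in> W" by simp
      then have "inverse c *s (c *s w) \<in> W" by (rule vec.subspace_scale[OF sW])
      then have "c = 0" using w(2) by (cases "c = 0") (auto simp: vec.scale_scale)
      then show "y \<in> ?H" using c by simp
    qed
  qed
  have wH: "w \<notin> vec.span ?H" using w(2) spH by blast
  have "vec.dim (pivot W w) = vec.dim (insert w ?H)" by (simp only: pivot_def vec.dim_span)
  also have "\<dots> = d" using dH by (simp only: vec.dim_insert if_not_P[OF wH])
  finally have "vec.dim (pivot W w) = d" .
  moreover have "Q y = 0" if "y \<in> pivot W w" for y
  proof -
    have "\<exists>c. y - c *s w \<in> ?H" using that by (simp only: mem)
    then obtain c where c: "y - c *s w \<in> ?H" ..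
    have "Q y = Q ((y - c *s w) + c *s w)" by simp
    also have "\<dots> = 0"
      unfolding Q_add using c w(1) generatorD(2)[OF W, of "y - c *s w"]
      by (simp add: Q_scale B_scale B_sym[of _ w])
    finally show ?thesis .
  qed
  ultimately have "pivot W w \<in> G"
    by (simp add: generators_def totally_singular_def) (simp add: pivot_def)
  then show "adjacent W (pivot W w)" using W dH meet by (simp add: adjacent_def)
  show "w \<in> pivot W w" by (simp add: pivot_def vec.span_base)
qed

text \<open>
  Connectedness of the dual polar graph: replacing \<open>U\<close> by its pivot towards a vector of \<open>W\<close> outside \<open>U\<close>
  keeps \<open>U \<inter> W\<close> and adds that vector to it, so finitely many steps lead from \<open>U\<close> to \<open>W\<close>.
\<close>

lemma generator_adjacent_induct:
  assumes U: "U \<in> G" and W: "W \<in> G" and base: "P W"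
    and step: "\<And>A A'. adjacent A A' \<Longrightarrow> P A \<Longrightarrow> P A'"
  shows "P U"
  using U
proof (induction "d - vec.dim (U \<inter> W)" arbitrary: U rule: less_induct)
  case less
  show ?case
  proof (cases "U = W")
    case True
    then show ?thesis using base by simp
  next
    case False
    then obtain w where w: "w \<in> W" "w \<notin> U" using generator_not_subset[OF less.prems W] by blast
    let ?U = "pivot U w"
    note piv = pivot_generator[OF less.prems generatorD(2)[OF W w(1)] w(2)]
    have "U \<inter> W \<subset> ?U \<inter> W" using piv(2,3) w generator_orth[OF W w(1)] by blast
    then have "vec.span (U \<inter> W) \<subset> vec.span (?U \<inter> W)"
      using subspace_meet[OF less.prems W] subspace_meet[OF adjacentD(2)[OF piv(1)] W]
      by (simp only: vec.span_eq_iff[THEN iffD2])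
    then have "vec.dim (U \<inter> W) < vec.dim (?U \<inter> W)" by (rule vec.dim_psubset)
    moreover have "vec.dim (?U \<inter> W) \<le> d"
      using vec.dim_subset[of "?U \<inter> W" W] generatorD(3)[OF W] by simp
    ultimately have "P ?U" using less.hyps[of ?U] adjacentD(2)[OF piv(1)] by simp
    then show ?thesis using step adjacent_sym[OF piv(1)] by blast
  qed
qed

section \<open>Latins and greeks\<close>

definition same_class :: "('a^'n) set \<Rightarrow> ('a^'n) set \<Rightarrow> bool" where
  "same_class U W \<longleftrightarrow> even (d - vec.dim (U \<inter> W))"

lemma dim_meet_le: "U \<in> G \<Longrightarrow> vec.dim (U \<inter> W) \<le> d"
  using vec.dim_subset[of "U \<inter> W" U] generatorD(3) by simp

lemma same_class_sym: "same_class U W \<longleftrightarrow> same_class W U"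
  by (simp add: same_class_def Int_commute)

lemma same_class_refl: "U \<in> G \<Longrightarrow> same_class U U"
  by (simp add: same_class_def generatorD(3))

lemma adjacent_same_class:
  assumes "adjacent W W'" "U \<in> G"
  shows "same_class W' U \<longleftrightarrow> \<not> same_class W U"
  using adjacent_dim_meet[OF assms] dim_meet_le[OF adjacentD(1)[OF assms(1)], of U]
    dim_meet_le[OF adjacentD(2)[OF assms(1)], of U]
  unfolding same_class_def by (auto simp: even_diff_nat)

text \<open>
  The equivalence says more than transitivity: it also states that there are at most two
  classes. Moving \<open>U\<close> to an adjacent generator flips both sides, so it suffices to check \<open>U = W\<close>.
\<close>

lemma same_class_trans:
  assumes "U \<in> G" "W \<in> G" "V \<in> G"
  shows "same_class U V \<longleftrightarrow> (same_class U W \<longleftrightarrow> same_class W V)"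
  using assms(1,2)
proof (rule generator_adjacent_induct)
  show "same_class W V \<longleftrightarrow> (same_class W W \<longleftrightarrow> same_class W V)"
    using same_class_refl[OF assms(2)] by simp
qed (use adjacent_same_class assms in blast)

text \<open>
  For \<open>Q a \<noteq> 0\<close> this is the orthogonal reflection in \<open>a\<close>, and the orthogonal transvection along \<open>a\<close> in
  characteristic 2.
\<close>

definition reflect :: "'a^'n \<Rightarrow> 'a^'n \<Rightarrow> 'a^'n" where
  "reflect a v = v - (B v a / Q a) *s a"

lemma linear_reflect: "Vector_Spaces.linear (*s) (*s) (reflect a)"
  unfolding Vector_Spaces.linear_iff
  by (simp add: vec.vector_space_axioms reflect_def B_add B_scale add_divide_distrib vec.scale_left_distrib
      vec.scale_right_diff_distrib vec.scale_scale)

lemma Q_reflect: "Q a \<noteq> 0 \<Longrightarrow> Q (reflect a v) = Q v"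
  by (simp add: reflect_def Q_diff Q_scale B_scale power2_eq_square)

lemma reflect_reflect:
  assumes "Q a \<noteq> 0"
  shows "reflect a (reflect a v) = v"
proof -
  have "B (reflect a v) a = - B v a" using assms by (simp add: reflect_def B_diff B_scale B_self)
  then show ?thesis by (simp add: reflect_def[of a "reflect a v"]) (simp add: reflect_def)
qed

lemma inj_reflect: "Q a \<noteq> 0 \<Longrightarrow> inj (reflect a)"
  by (metis injI reflect_reflect)

lemma dim_reflect: "Q a \<noteq> 0 \<Longrightarrow> vec.dim (reflect a ` S) = vec.dim S"
  by (rule vec.dim_image_eq[OF linear_reflect]) (blast intro: inj_on_subset inj_reflect)

lemma reflect_generator:
  assumes "Q a \<noteq> 0" "U \<in> G"
  shows "reflect a ` U \<in> G"
  using assms dim_reflect[of a U] vec.linear_subspace_image[OF linear_reflect] Q_reflect[of a]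
  by (auto simp: generators_def totally_singular_def)

lemma dim_meet_reflect:
  assumes "Q a \<noteq> 0"
  shows "vec.dim (reflect a ` U \<inter> reflect a ` W) = vec.dim (U \<inter> W)"
  using dim_reflect[OF assms, of "U \<inter> W"] image_Int[OF inj_reflect[OF assms], of U W] by simp

lemma same_class_reflect: "Q a \<noteq> 0 \<Longrightarrow> same_class (reflect a ` U) (reflect a ` W) \<longleftrightarrow> same_class U W"
  by (simp add: same_class_def dim_meet_reflect)

text \<open>
  For \<open>u \<in> U\<close> and \<open>u' \<in> U'\<close> outside the common hyperplane, \<open>a = u - u'\<close> is nonsingular because \<open>u\<close> and \<open>u'\<close>
  are not orthogonal. The reflection in \<open>a\<close> sends \<open>u\<close> to \<open>u'\<close> and fixes the common hyperplane, which is
  orthogonal to both.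
\<close>

lemma adjacent_reflect:
  assumes adj: "adjacent U U'"
  obtains a where "Q a \<noteq> 0" "reflect a ` U = U'"
proof -
  note U = adjacentD[OF adj]
  obtain u where u: "u \<in> U" "u \<notin> U'" using generator_not_subset[OF U(2,1)] adjacent_neq[OF adj] by metis
  obtain u' where u': "u' \<in> U'" "u' \<notin> U" using generator_not_subset[OF U] adjacent_neq[OF adj] by metis
  have Qu: "Q u = 0" "Q u' = 0" using generatorD(2)[OF U(1) u(1)] generatorD(2)[OF U(2) u'(1)] by auto
  define a where "a = u - u'"
  have Qa: "Q a = - B u u'" by (simp add: a_def Q_diff Qu)
  have Qa0: "Q a \<noteq> 0" using Qa adjacent_nonorthogonal[OF adj u u'] by simp
  have ru: "reflect a u = u'"
  proof -
    have "B u a = Q a" unfolding Qa by (simp add: a_def B_diff B_self Qu)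
    then show ?thesis using Qa0 by (simp add: reflect_def) (simp add: a_def)
  qed
  have "reflect a ` U \<subseteq> U'"
  proof (rule image_subsetI)
    fix y assume "y \<in> U"
    then obtain c where c: "y - c *s u \<in> U \<inter> U'" using adjacent_decompose[OF adj u] by blast
    have "B (y - c *s u) a = 0"
      unfolding a_def B_diff(2)
      using generator_orth[OF U(1) _ u(1), of "y - c *s u"] generator_orth[OF U(2) _ u'(1), of "y - c *s u"] c
      by simp
    then have fixed: "reflect a (y - c *s u) = y - c *s u" by (simp add: reflect_def)
    have "reflect a y = reflect a ((y - c *s u) + c *s u)" by simp
    also have "\<dots> = reflect a (y - c *s u) + c *s reflect a u"
      by (simp only: vec.linear_add[OF linear_reflect] vec.linear_scale[OF linear_reflect])
    also have "\<dots> = (y - c *s u) + c *s u'" by (simp only: fixed ru)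
    also have "\<dots> \<in> U'"
      using c u' generatorD(1)[OF U(2)] by (blast intro: vec.subspace_add vec.subspace_scale)
    finally show "reflect a y \<in> U'" .
  qed
  then have "reflect a ` U = U'"
    using vec.subspace_dim_equal[OF generatorD(1)[OF reflect_generator[OF Qa0 U(1)]] generatorD(1)[OF U(2)]]
      generatorD(3)[OF reflect_generator[OF Qa0 U(1)]] generatorD(3)[OF U(2)] by simp
  then show thesis using that Qa0 by blast
qed

lemma inj_on_reflect_image: "Q a \<noteq> 0 \<Longrightarrow> inj_on ((`) (reflect a)) \<C>"
  by (rule inj_onI) (simp add: inj_image_eq_iff inj_reflect)

lemma even_latins_and_greeks_meet:
  assumes "latins_and_greeks d Q X1 X2" "even d" "x \<in> X1" "y \<in> X2"
  shows "vec.dim (x \<inter> y) \<noteq> 0"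
proof -
  have "odd (d - vec.dim (x \<inter> y))" using assms unfolding latins_and_greeks_def by blast
  then show ?thesis using assms(2) by (metis diff_zero)
qed

section \<open>Generators in general position\<close>

text \<open>
  A vector orthogonal to neither \<open>x\<close> nor \<open>y\<close> exists over every field, since no vector space is the union of
  two proper subspaces. Adding a multiple of \<open>x\<close> makes it singular and does not change its products with
  \<open>x\<close> and \<open>y\<close>, because these lie in a common totally singular subspace.
\<close>

lemma exists_singular_nonorthogonal:
  assumes W: "W \<in> G" and x: "x \<in> W" "x \<noteq> 0" and y: "y \<in> W" "y \<noteq> 0"
  obtains w where "Q w = 0" "B w x \<noteq> 0" "B w y \<noteq> 0"
proof -
  obtain z1 where z1: "B z1 x \<noteq> 0"
    using nondegenerate[of x] generatorD(2)[OF W x(1)] x(2) B_sym by metis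
  obtain z2 where z2: "B z2 y \<noteq> 0"
    using nondegenerate[of y] generatorD(2)[OF W y(1)] y(2) B_sym by metis
  obtain z where z: "B z x \<noteq> 0" "B z y \<noteq> 0"
  proof (cases "B z1 y = 0 \<and> B z2 x = 0")
    case True
    then show ?thesis using that[of "z1 + z2"] z1 z2 by (simp add: B_add)
  qed (use that z1 z2 in blast)
  define w where "w = z - (Q z / B z x) *s x"
  have "Q w = 0" using z generatorD(2)[OF W x(1)] by (simp add: w_def Q_diff Q_scale B_scale)
  moreover have "B w x = B z x" "B w y = B z y"
    using generator_orth[OF W x(1) x(1)] generator_orth[OF W x(1) y(1)]
    by (simp_all add: w_def B_diff B_scale)
  ultimately show thesis using that z by simp
qed

lemma meet_nonzero:
  assumes "0 < vec.dim (W \<inter> U)"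
  obtains x where "x \<in> W" "x \<in> U" "x \<noteq> 0"
proof -
  have "\<not> W \<inter> U \<subseteq> {0}" using assms by (metis vec.dim_eq_0 less_numeral_extra(3))
  then show thesis using that by blast
qed

text \<open>
  Pivoting \<open>W\<close> towards a singular vector orthogonal neither to \<open>x \<in> W \<inter> U\<close> nor to \<open>y \<in> W \<inter> V\<close> expels both \<open>x\<close>
  and \<open>y\<close>.
\<close>

lemma adjacent_reducing_both:
  assumes W: "W \<in> G" and U: "U \<in> G" and V: "V \<in> G"
    and "0 < vec.dim (W \<inter> U)" "0 < vec.dim (W \<inter> V)"
  obtains W' where "adjacent W W'" "vec.dim (W \<inter> U) = vec.dim (W' \<inter> U) + 1"
    "vec.dim (W \<inter> V) = vec.dim (W' \<inter> V) + 1"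
proof -
  obtain x where x: "x \<in> W" "x \<in> U" "x \<noteq> 0" using assms(4) by (rule meet_nonzero)
  obtain y where y: "y \<in> W" "y \<in> V" "y \<noteq> 0" using assms(5) by (rule meet_nonzero)
  obtain w where w: "Q w = 0" "B w x \<noteq> 0" "B w y \<noteq> 0"
    by (rule exists_singular_nonorthogonal[OF W x(1,3) y(1,3)])
  have "w \<notin> W" using generator_orth[OF W _ x(1)] w(2) by blast
  note piv = pivot_generator[OF W w(1) this]
  have "x \<notin> pivot W w" "y \<notin> pivot W w" using piv(3) x(1) y(1) w by blast+
  then show thesis using that[OF piv(1)] dim_meet_drop[OF piv(1)] U V x y by blast
qed

lemma exists_adjacent:
  assumes "U \<in> G"
  obtains U' where "adjacent U U'"
proof -
  have meet: "0 < vec.dim (U \<inter> U)" using d_pos generatorD(3)[OF assms] by simp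
  obtain U' where "adjacent U U'" by (rule adjacent_reducing_both[OF assms assms assms meet meet])
  then show thesis by (rule that)
qed

text \<open>
  Every step changes the dimension of \<open>W \<inter> V\<close>, so \<open>W \<inter> V = 0\<close> cannot be kept in one step. The first of two steps
  creates a common point with \<open>V\<close> at the price of one dimension of \<open>W \<inter> U\<close>; the second removes one
  dimension from both sides.
\<close>

lemma reduce_one_sided:
  assumes W: "W \<in> G" and U: "U \<in> G" and V: "V \<in> G"
    and a: "2 \<le> vec.dim (W \<inter> U)" and b: "vec.dim (W \<inter> V) = 0"
  obtains W' where "W' \<in> G" "vec.dim (W \<inter> U) = vec.dim (W' \<inter> U) + 2" "vec.dim (W' \<inter> V) = 0"
proof -
  have pos: "0 < vec.dim (W \<inter> U)" using a by linarith
  obtain W1 where W1: "adjacent W W1" "vec.dim (W \<inter> U) = vec.dim (W1 \<inter> U) + 1"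
    by (rule adjacent_reducing_both[OF W U U pos pos])
  have V1: "vec.dim (W1 \<inter> V) = 1" using adjacent_dim_meet[OF W1(1) V] b by linarith
  have pos1: "0 < vec.dim (W1 \<inter> U)" "0 < vec.dim (W1 \<inter> V)" using W1(2) a V1 by linarith+
  obtain W2 where W2: "adjacent W1 W2" "vec.dim (W1 \<inter> U) = vec.dim (W2 \<inter> U) + 1"
      "vec.dim (W1 \<inter> V) = vec.dim (W2 \<inter> V) + 1"
    by (rule adjacent_reducing_both[OF adjacentD(2)[OF W1(1)] U V pos1])
  show thesis by (rule that[OF adjacentD(2)[OF W2(1)]]) (use W1 W2 V1 in linarith)+
qed

text \<open>
  Descent on \<open>dim (W \<inter> U) + dim (W \<inter> V)\<close>, starting anywhere. As \<open>U\<close> and \<open>V\<close> are in the same class, the two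
  dimensions have the same parity. Hence if exactly one of them is zero, the other is at least 2, and
  \<open>reduce_one_sided\<close> applies.
\<close>

lemma common_opposite:
  assumes U: "U \<in> G" and V: "V \<in> G" and UV: "same_class U V"
  obtains W where "W \<in> G" "vec.dim (W \<inter> U) = 0" "vec.dim (W \<inter> V) = 0"
proof -
  have "\<exists>W\<in>G. vec.dim (W \<inter> U) = 0 \<and> vec.dim (W \<inter> V) = 0" if "W \<in> G" for W
    using that
  proof (induction "vec.dim (W \<inter> U) + vec.dim (W \<inter> V)" arbitrary: W rule: less_induct)
    case less
    note W = less.prems
    have "same_class W U \<longleftrightarrow> same_class W V"
      using same_class_trans[OF W U V] UV by simp
    then have par: "even (vec.dim (W \<inter> U)) \<longleftrightarrow> even (vec.dim (W \<inter> V))"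
      using dim_meet_le[OF W, of U] dim_meet_le[OF W, of V] by (auto simp: same_class_def)
    have "a = 0 \<and> b = 0 \<or> 0 < a \<and> 0 < b \<or> 2 \<le> a \<and> b = 0 \<or> a = 0 \<and> 2 \<le> b"
      if "even a \<longleftrightarrow> even b" for a b :: nat
      using that by presburger
    from this[OF par] consider "vec.dim (W \<inter> U) = 0" "vec.dim (W \<inter> V) = 0"
      | "0 < vec.dim (W \<inter> U)" "0 < vec.dim (W \<inter> V)"
      | "2 \<le> vec.dim (W \<inter> U)" "vec.dim (W \<inter> V) = 0"
      | "vec.dim (W \<inter> U) = 0" "2 \<le> vec.dim (W \<inter> V)"
      by (elim disjE conjE)
    then show ?case
    proof cases
      case 1
      then show ?thesis using W by blast
    next
      case 2
      obtain W' where "adjacent W W'" "vec.dim (W \<inter> U) = vec.dim (W' \<inter> U) + 1"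
        "vec.dim (W \<inter> V) = vec.dim (W' \<inter> V) + 1"
        by (rule adjacent_reducing_both[OF W U V 2])
      then show ?thesis using less.hyps[of W'] adjacentD(2) by simp
    next
      case 3
      obtain W' where "W' \<in> G" "vec.dim (W \<inter> U) = vec.dim (W' \<inter> U) + 2" "vec.dim (W' \<inter> V) = 0"
        by (rule reduce_one_sided[OF W U V 3])
      then show ?thesis using less.hyps[of W'] by simp
    next
      case 4
      obtain W' where "W' \<in> G" "vec.dim (W \<inter> V) = vec.dim (W' \<inter> V) + 2" "vec.dim (W' \<inter> U) = 0"
        by (rule reduce_one_sided[OF W V U 4(2,1)])
      then show ?thesis using less.hyps[of W'] by simp
    qed
  qed
  then show thesis using that U by blast
qed

definition opposites :: "('a^'n) set \<Rightarrow> ('a^'n) set set" where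
  "opposites U = {W\<in>G. vec.dim (U \<inter> W) = 0}"

lemma card_opposites_adjacent_le:
  assumes "adjacent U U'"
  shows "card (opposites U) \<le> card (opposites U')"
proof -
  obtain a where a: "Q a \<noteq> 0" "reflect a ` U = U'" by (rule adjacent_reflect[OF assms])
  show ?thesis
  proof (rule card_inj_on_le[OF inj_on_reflect_image[OF a(1)]])
    show "(`) (reflect a) ` opposites U \<subseteq> opposites U'"
      using dim_meet_reflect[OF a(1), of U] reflect_generator[OF a(1)]
      unfolding opposites_def a(2) by fastforce
  qed simp
qed

lemma card_opposites:
  assumes "U \<in> G" "W \<in> G"
  shows "card (opposites U) = card (opposites W)"
  using assms
proof (rule generator_adjacent_induct)
  fix A A' assume "adjacent A A'" "card (opposites A) = card (opposites W)"
  then show "card (opposites A') = card (opposites W)"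
    using card_opposites_adjacent_le[of A A'] card_opposites_adjacent_le[OF adjacent_sym, of A A'] by simp
qed simp

lemma card_opposites_pos: "U \<in> G \<Longrightarrow> 0 < card (opposites U)"
  using common_opposite[of U U] same_class_refl[of U]
  by (auto simp: opposites_def card_gt_0_iff Int_commute)

text \<open>
  The classes have equal size because the reflection that moves \<open>U\<close> to an adjacent generator exchanges them.
\<close>

lemma latins_and_greeks_classes:
  assumes U: "U \<in> G"
  shows "latins_and_greeks d Q {W\<in>G. same_class W U} {W\<in>G. \<not> same_class W U}"
proof -
  let ?X1 = "{W\<in>G. same_class W U}" and ?X2 = "{W\<in>G. \<not> same_class W U}"
  obtain U' where adj: "adjacent U U'" using U by (rule exists_adjacent)
  obtain a where a: "Q a \<noteq> 0" "reflect a ` U = U'" by (rule adjacent_reflect[OF adj])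
  have swap: "same_class (reflect a ` W) U \<longleftrightarrow> \<not> same_class W U" if "W \<in> G" for W
    using same_class_reflect[OF a(1), of W U] adjacent_same_class[OF adj reflect_generator[OF a(1) that]]
    unfolding a(2) same_class_sym[of "reflect a ` W"] by blast
  have "card ?X1 \<le> card ?X2"
    by (rule card_inj_on_le[OF inj_on_reflect_image[OF a(1)]])
      (use swap reflect_generator[OF a(1)] in auto)
  moreover have "card ?X2 \<le> card ?X1"
    by (rule card_inj_on_le[OF inj_on_reflect_image[OF a(1)]])
      (use swap reflect_generator[OF a(1)] in auto)
  ultimately have "card ?X1 = card ?X2" by simp
  then show ?thesis
    unfolding latins_and_greeks_def same_class_def[symmetric]
    using same_class_trans[OF _ U] same_class_sym by auto
qed

end

section \<open>Independent pairs in a regular graph\<close>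

text \<open>
  Count the edges between \<open>Z\<close> and the complement of \<open>Y\<close>: there are exactly \<open>k\<close> at every vertex of \<open>Z\<close>,
  and at most \<open>k\<close> at every vertex of the complement. In the case of equality there is no room
  for an edge from the complement of \<open>Y\<close> to a vertex outside \<open>Z\<close>.
\<close>

lemma regular_graph_independent_pair:
  fixes G :: "'v set"
  assumes fin: "finite G" and sym: "\<And>v w. R v w \<Longrightarrow> R w v"
    and reg: "\<And>v. v \<in> G \<Longrightarrow> card {w\<in>G. R v w} = k" and k: "0 < k"
    and Y: "Y \<subseteq> G" and Z: "Z \<subseteq> G" and indep: "\<And>y z. y \<in> Y \<Longrightarrow> z \<in> Z \<Longrightarrow> \<not> R y z"
  shows "card Y + card Z \<le> card G"
    and "card Y + card Z = card G \<Longrightarrow> c \<in> G - Y \<Longrightarrow> w \<in> G \<Longrightarrow> R c w \<Longrightarrow> w \<in> Z"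
proof -
  let ?C = "G - Y"
  have finC: "finite ?C" and finZ: "finite Z" using fin Z finite_subset by auto
  have cC: "card ?C + card Y = card G"
    using card_mono[OF fin Y] card_Diff_subset[OF finite_subset[OF Y fin] Y] by simp
  have "{w\<in>?C. R w z} = {w\<in>G. R z w}" if "z \<in> Z" for z
    using indep sym that by blast
  then have "\<forall>z\<in>Z. card {w\<in>?C. R w z} = k" using reg Z by auto
  then have edges: "(\<Sum>c\<in>?C. card {z\<in>Z. R c z}) = k * card Z"
    by (rule sum_multicount[OF finC finZ])
  have le: "card {z\<in>Z. R c z} \<le> k" if "c \<in> ?C" for c
  proof -
    have "card {z\<in>Z. R c z} \<le> card {z\<in>G. R c z}" using fin Z by (intro card_mono) auto
    then show ?thesis using reg that by simp
  qed
  have "(\<Sum>c\<in>?C. card {z\<in>Z. R c z}) \<le> (\<Sum>c\<in>?C. k)" by (rule sum_mono[OF le])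
  then have "k * card Z \<le> k * card ?C" using edges by (simp add: mult.commute)
  then show "card Y + card Z \<le> card G" using k cC by simp
  assume eq: "card Y + card Z = card G" and c: "c \<in> G - Y" and w: "w \<in> G" "R c w"
  show "w \<in> Z"
  proof (rule ccontr)
    assume "w \<notin> Z"
    then have "{z\<in>Z. R c z} \<subset> {z\<in>G. R c z}" using w Z by blast
    then have "card {z\<in>Z. R c z} < k"
      using psubset_card_mono[of "{z\<in>G. R c z}"] fin reg c by simp
    then have "(\<Sum>c\<in>?C. card {z\<in>Z. R c z}) < (\<Sum>c\<in>?C. k)"
      using le c finC by (intro sum_strict_mono_ex1) auto
    then have "k * card Z < k * card ?C" using edges by (simp add: mult.commute)
    then show False using eq cC by simp
  qed
qed

text \<open>
  From \<open>(y + z)^2 \<le> 4 m^2 \<le> 4 y z\<close> follows \<open>(y - z)^2 \<le> 0\<close>.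
\<close>

lemma equal_if_product_ge_square:
  fixes y z m :: nat
  assumes "y + z \<le> 2 * m" "m * m \<le> y * z"
  shows "y = m \<and> z = m"
proof -
  let ?y = "int y" and ?z = "int z" and ?m = "int m"
  have s: "?y + ?z \<le> 2 * ?m" using assms(1) by linarith
  have p: "?m * ?m \<le> ?y * ?z" using assms(2) by (metis of_nat_le_iff of_nat_mult)
  have "(?y + ?z)\<^sup>2 \<le> (2 * ?m)\<^sup>2" using s by (intro power_mono) auto
  then have "(?y - ?z)\<^sup>2 \<le> 0" using p by (simp add: power2_eq_square algebra_simps)
  then have yz: "y = z" by simp
  then have "?m\<^sup>2 \<le> ?y\<^sup>2" using p by (simp add: power2_eq_square)
  then have "m \<le> y" using power2_le_imp_le[of ?m ?y] by simp
  then show ?thesis using yz assms(1) by linarith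
qed

section \<open>Maximum cross-intersecting pairs of generators\<close>

theorem theorem5p3:
  fixes Q :: "'a::{field,finite}^'n \<Rightarrow> 'a" and d :: nat
    and Y Z :: "('a^'n) set set"
  assumes "hyperbolic_quadric d Q"
    and "even d"
    and "maximum_cross_intersecting_EKR d Q Y Z"
  shows "(\<exists>X1 X2. latins_and_greeks d Q X1 X2) \<and>
    (\<forall>X1 X2. latins_and_greeks d Q X1 X2 \<longrightarrow> (Y = X1 \<and> Z = X2) \<or> (Y = X2 \<and> Z = X1))"
proof -
  interpret hyperbolic_space d Q by unfold_locales (rule assms(1))
  have "cross_intersecting_EKR d Q Y Z"
    using assms(3) by (simp add: maximum_cross_intersecting_EKR_def)
  then have YZ: "Y \<subseteq> G" "Z \<subseteq> G" "\<And>y z. y \<in> Y \<Longrightarrow> z \<in> Z \<Longrightarrow> vec.dim (y \<inter> z) \<noteq> 0"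
    by (simp_all add: cross_intersecting_EKR_def Suc_le_eq)
  have max: "card X1 * card X2 \<le> card Y * card Z" if LG: "latins_and_greeks d Q X1 X2" for X1 X2
  proof -
    have "cross_intersecting_EKR d Q X1 X2"
      using LG even_latins_and_greeks_meet[OF LG assms(2)]
      by (auto simp: cross_intersecting_EKR_def latins_and_greeks_def Suc_le_eq)
    then show ?thesis using assms(3) by (simp add: maximum_cross_intersecting_EKR_def)
  qed
  obtain U where U: "U \<in> G" using generators_nonempty by blast
  define k where "k = card (opposites U)"
  have k: "0 < k" "\<And>W. W \<in> G \<Longrightarrow> card {V\<in>G. vec.dim (W \<inter> V) = 0} = k"
    using card_opposites_pos[OF U] card_opposites[OF _ U] by (simp_all add: k_def opposites_def)
  have fin: "finite G" by simp
  have symm: "vec.dim (W \<inter> V) = 0" if "vec.dim (V \<inter> W) = 0" for V W :: "('a^'n) set"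
    using that by (simp only: Int_commute)
  let ?opp = "\<lambda>V W :: ('a^'n) set. vec.dim (V \<inter> W) = 0"
  have sum_le: "card Y + card Z \<le> card G"
    by (rule regular_graph_independent_pair(1)[where R = ?opp and k = k, OF fin])
      (fact symm k YZ | assumption)+
  have tight_graph: "w \<in> Z"
    if "card Y + card Z = card G" "c \<in> G - Y" "w \<in> G" "vec.dim (c \<inter> w) = 0" for c w
    by (rule regular_graph_independent_pair(2)[where R = ?opp and k = k and c = c and Y = Y, OF fin])
      (fact symm k YZ that | assumption)+
  \<comment> \<open>The names of the two classes are interchangeable, so let \<open>X1\<close> be one that contains an element of \<open>Z\<close>.\<close>
  have main: "Y = X2 \<and> Z = X1"
    if LG: "latins_and_greeks d Q X1 X2" and z: "z \<in> Z" "z \<in> X1" for X1 X2 z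
  proof -
    have X: "X1 \<union> X2 = G" "X1 \<inter> X2 = {}" "card X1 = card X2"
      and same: "\<And>x y. x \<in> X1 \<Longrightarrow> y \<in> X1 \<Longrightarrow> even (d - vec.dim (x \<inter> y))"
      using LG by (auto simp: latins_and_greeks_def)
    define m where "m = card X1"
    have cG: "card G = 2 * m"
      using card_Un_disjoint[of X1 X2] X by (simp add: m_def)
    note not_opp = even_latins_and_greeks_meet[OF LG assms(2)]
    have "m * m \<le> card Y * card Z" using max[OF LG] X(3) by (simp add: m_def)
    moreover have "card Y + card Z \<le> 2 * m" using sum_le cG by simp
    ultimately have cards: "card Y = m" "card Z = m" using equal_if_product_ge_square by blast+
    have tight: "w \<in> Z" if "c \<in> G - Y" "w \<in> G" "vec.dim (c \<inter> w) = 0" for c w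
      using tight_graph[OF _ that] cards cG by simp
    have "X1 \<subseteq> Z"
    proof
      fix x assume x: "x \<in> X1"
      have "same_class z x" using same[OF z(2) x] by (simp add: same_class_def)
      then obtain c where c: "c \<in> G" "vec.dim (c \<inter> z) = 0" "vec.dim (c \<inter> x) = 0"
        using common_opposite[of z x] x z X(1) by blast
      then have "c \<notin> Y" using YZ(3) z(1) by blast
      then show "x \<in> Z" using tight[of c x] c x X(1) by blast
    qed
    then have "X1 = Z" by (rule card_subset_eq[OF finite]) (simp add: cards m_def[symmetric])
    then have ZX: "Z = X1" by (rule sym)
    have "X2 \<subseteq> Y"
    proof
      fix c assume c: "c \<in> X2"
      then obtain w where w: "w \<in> G" "vec.dim (w \<inter> c) = 0"
        using common_opposite[of c c] same_class_refl[of c] X(1) by blast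
      show "c \<in> Y"
      proof (rule ccontr)
        assume "c \<notin> Y"
        then have "w \<in> X1" using tight[of c w] w(1) symm[OF w(2)] c X(1) ZX by blast
        then show False using not_opp c w(2) by blast
      qed
    qed
    then have "X2 = Y" by (rule card_subset_eq[OF finite]) (simp add: cards X(3)[symmetric] m_def[symmetric])
    then show ?thesis using ZX by blast
  qed
  have "(Y = X1 \<and> Z = X2) \<or> (Y = X2 \<and> Z = X1)" if LG: "latins_and_greeks d Q X1 X2" for X1 X2
  proof -
    have X: "X1 \<union> X2 = G" "X1 \<inter> X2 = {}" "card X1 = card X2"
      using LG by (auto simp: latins_and_greeks_def)
    have LG': "latins_and_greeks d Q X2 X1"
      using LG unfolding latins_and_greeks_def
      by (simp only: Un_commute[of X2] Int_commute[of X2]) (metis Int_commute)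
    \<comment> \<open>The pair of the two classes has a positive product of sizes, so a maximum pair has no empty part.\<close>
    have "0 < card G" using U by (simp add: card_gt_0_iff) blast
    then have "0 < card X1 * card X2" using card_Un_disjoint[of X1 X2] X by simp
    then have "Z \<noteq> {}" using max[OF LG] by auto
    then obtain z where "z \<in> Z" by blast
    then show ?thesis using main[OF LG] main[OF LG'] YZ(2) X(1) by blast
  qed
  then show ?thesis using latins_and_greeks_classes[OF U] by blast
qed

end
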